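(* There exist a discrete valuation ring $V$ and a square-zero extension $R$ of $V$ such that $R$ is a Noetherian ring of Krull dimension one with a unique minimal prime ideal $\mathfrak p$, $\mathfrak p^2=0$, $R/\mathfrak p\cong V$ (in particular $R/\mathfrak p$ is a principal ideal domain), $\operatorname{Min} R\subsetneq\operatorname{Ass} R$, and $R$ is not iso-Artinian. In other words, the following question has a negative answer, already among square-zero extensions of discrete valuation rings: if $R$ is a one-dimensional Noetherian ring with a unique minimal prime $\mathfrak p$, if $R/\mathfrak p$ is a principal ideal domain, and if $\operatorname{Min} R\subsetneq\operatorname{Ass} R$, must $R$ be iso-Artinian?
   Context: All rings are commutative with identity and all modules are unital. A commutative ring $R$ is called iso-Artinian if for every descending chain of ideals $I_1\supseteq I_2\supseteq I_3\supseteq\cdots$ of $R$ there exists $n_0$ such that $I_n\cong I_{n_0}$ as $R$-modules for every $n\ge n_0$. $\operatorname{Min} R$ is the set of minimal prime ideals of $R$ and $\operatorname{Ass} R$ is the set of associated primes of $R$ as an $R$-module. A square-zero extension of $V$ is a ring $R$ with a surjective ring homomorphism $R\to V$ whose kernel has square zero. *)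

theory Defs
  imports
    "HOL-Algebra.Ring_Divisibility"
    "HOL-Algebra.Ideal_Product"
    "HOL-Algebra.QuotRing"
    "HOL-Library.Extended_Nat"
    "HOL-Computational_Algebra.Formal_Power_Series"
begin

text \<open>Serre's definition: a principal ideal domain with a unique nonzero prime ideal.\<close>

definition discrete_valuation_ring :: "('a, 'm) ring_scheme \<Rightarrow> bool" where
  "discrete_valuation_ring V \<longleftrightarrow>
     principal_domain V \<and> (\<exists>!P. primeideal P V \<and> P \<noteq> {\<zero>\<^bsub>V\<^esub>})"

definition square_zero_extension ::
    "('a, 'm) ring_scheme \<Rightarrow> ('b, 'n) ring_scheme \<Rightarrow> ('b \<Rightarrow> 'a) \<Rightarrow> bool" where
  "square_zero_extension V R f \<longleftrightarrow>
     cring V \<and> cring R \<and> f \<in> ring_hom R V \<and> f ` carrier R = carrier V \<and>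
     ideal_prod R (a_kernel R V f) (a_kernel R V f) = {\<zero>\<^bsub>R\<^esub>}"

text \<open>Supremum of the lengths \<open>n\<close> of chains \<open>P 0 \<subset> \<dots> \<subset> P n\<close> of prime ideals
  (with the junk value \<open>0\<close> for the zero ring).\<close>

definition krull_dim :: "('a, 'm) ring_scheme \<Rightarrow> enat" where
  "krull_dim R = Sup {enat n | n. \<exists>P :: nat \<Rightarrow> 'a set.
     (\<forall>i\<le>n. primeideal (P i) R) \<and> (\<forall>i<n. P i \<subset> P (Suc i))}"

definition Min_primes :: "('a, 'm) ring_scheme \<Rightarrow> 'a set set" where
  "Min_primes R = {P. primeideal P R \<and> (\<forall>Q. primeideal Q R \<and> Q \<subseteq> P \<longrightarrow> Q = P)}"

definition Ass_primes :: "('a, 'm) ring_scheme \<Rightarrow> 'a set set" where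
  "Ass_primes R = {P. primeideal P R \<and>
     (\<exists>x\<in>carrier R. P = {r \<in> carrier R. r \<otimes>\<^bsub>R\<^esub> x = \<zero>\<^bsub>R\<^esub>})}"

text \<open>Isomorphism of two ideals as \<open>R\<close>-modules.\<close>

definition ideal_iso :: "('a, 'm) ring_scheme \<Rightarrow> 'a set \<Rightarrow> 'a set \<Rightarrow> bool" where
  "ideal_iso R I J \<longleftrightarrow> (\<exists>h. bij_betw h I J \<and>
     (\<forall>x\<in>I. \<forall>y\<in>I. h (x \<oplus>\<^bsub>R\<^esub> y) = h x \<oplus>\<^bsub>R\<^esub> h y) \<and>
     (\<forall>r\<in>carrier R. \<forall>x\<in>I. h (r \<otimes>\<^bsub>R\<^esub> x) = r \<otimes>\<^bsub>R\<^esub> h x))"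

definition iso_artinian :: "('a, 'm) ring_scheme \<Rightarrow> bool" where
  "iso_artinian R \<longleftrightarrow> cring R \<and>
     (\<forall>I :: nat \<Rightarrow> 'a set. (\<forall>n. ideal (I n) R) \<and> (\<forall>n. I (Suc n) \<subseteq> I n) \<longrightarrow>
        (\<exists>n0. \<forall>n\<ge>n0. ideal_iso R (I n) (I n0)))"

text \<open>The hypotheses under which one asks whether \<open>R\<close> must be iso-Artinian.\<close>

definition question_hypotheses :: "('a, 'm) ring_scheme \<Rightarrow> 'a set \<Rightarrow> bool" where
  "question_hypotheses R p \<longleftrightarrow>
     cring R \<and> noetherian_ring R \<and> krull_dim R = 1 \<and> Min_primes R = {p} \<and>
     principal_domain (R Quot p) \<and> Min_primes R \<subset> Ass_primes R"

text \<open>HOL cannot quantify existentially over types, so an existence statement about rings has to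
  name types for their carriers. The carriers may be arbitrary subsets of these types, and a
  ring (or a counterexample) found over particular types is in particular a ring, so fixing the
  types can only strengthen the existence statement.\<close>

type_synonym base_type = "rat fps"
type_synonym ext_type = "rat fps \<times> rat fps \<times> rat"

end

theory Submission
  imports Defs
begin

text \<open>
  Let \<open>k\<close> be a field, \<open>V = k[[X]]\<close>, and let \<open>R\<close> be the trivial extension of \<open>V\<close> by the module
  \<open>M = V \<oplus> k\<close>: the elements of \<open>R\<close> are the triples \<open>(v, b, c)\<close> with \<open>v, b \<in> V\<close> and \<open>c \<in> k\<close>,
  and two elements of \<open>M\<close> multiply to zero. The projection \<open>fst\<close> is a ring homomorphism onto
  \<open>V\<close> with kernel \<open>p = M\<close>, so that \<open>p\<^sup>2 = 0\<close> and \<open>R/p \<simeq> V\<close>. Since \<open>p\<close> consists of nilpotents,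
  every prime of \<open>R\<close> is the preimage of a prime of \<open>V\<close>
  (\<open>primeideal_trivial_ext_ring_iff\<close>); these are \<open>p\<close> and the maximal ideal \<open>m\<close>, so the
  dimension is one and \<open>p\<close> is the only minimal prime. Both summands of \<open>M\<close> leave a trace in the
  associated primes: \<open>p\<close> annihilates the generator \<open>(0, 1, 0)\<close> of \<open>V\<close>, and \<open>m\<close> annihilates the
  generator \<open>(0, 0, 1)\<close> of the residue field. So the summand \<open>k\<close> makes \<open>m\<close> an embedded
  associated prime, while the summand \<open>V\<close> is what destroys the iso-Artinian property.

  For the latter, consider the ideals \<open>I = X\<^sup>d V \<oplus> X\<^sup>a V\<close> with \<open>a \<le> d\<close> and \<open>0 < d\<close>, the second
  summand lying inside \<open>M\<close>. The submodule of \<open>I\<close> annihilated by \<open>s = (0, 1, 0)\<close> is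
  \<open>0 \<oplus> X\<^sup>a V\<close>, and it contains \<open>s I = 0 \<oplus> X\<^sup>d V\<close>. Their quotient has length \<open>d - a\<close>, and an
  isomorphism of \<open>R\<close>-modules preserves it (\<open>ideal_iso_staircase_imp_le\<close>). Along the
  descending chain \<open>d = 2 n\<close>, \<open>a = n\<close> this length is \<open>n\<close>, so that no two members are
  isomorphic.
\<close>

section \<open>Ideals and prime chains in commutative rings\<close>

lemma (in cring) ideal_if_closed:
  assumes "I \<subseteq> carrier R" "\<zero> \<in> I"
    and add: "\<And>x y. x \<in> I \<Longrightarrow> y \<in> I \<Longrightarrow> x \<oplus> y \<in> I"
    and mult: "\<And>r x. r \<in> carrier R \<Longrightarrow> x \<in> I \<Longrightarrow> r \<otimes> x \<in> I"
  shows "ideal I R"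
proof (rule idealI)
  show "subgroup I (add_monoid R)"
  proof (rule add.subgroupI)
    fix x assume x: "x \<in> I"
    hence "\<ominus> x = (\<ominus> \<one>) \<otimes> x" using assms(1) by (simp add: l_minus subset_iff)
    thus "\<ominus> x \<in> I" using mult[of "\<ominus> \<one>" x] x by simp
  qed (use assms in auto)
next
  fix a x assume "a \<in> I" "x \<in> carrier R"
  thus "x \<otimes> a \<in> I" "a \<otimes> x \<in> I" using mult[of x a] assms(1) m_comm[of a x] by auto
qed (rule ring_axioms)

text \<open>An ideal of the target is generated by the image of a generator of its preimage.\<close>

lemma principal_domain_ring_iso:
  assumes "principal_domain V" "ring S" "V \<simeq> S"
  shows "principal_domain S"
proof -
  interpret V: principal_domain V by fact
  interpret S: ring S by fact
  obtain h where h: "h \<in> ring_iso V S" using assms(3) by (auto simp: is_ring_iso_def)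
  interpret h: ring_hom_ring V S h
    using h V.ring_axioms S.ring_axioms
    by (auto simp: ring_iso_def intro!: ring_hom_ringI2)
  have surj: "h ` carrier V = carrier S" using h by (auto simp: ring_iso_def bij_betw_def)
  have "domain S"
    using V.ring_iso_imp_img_domain[OF h] h.hom_zero by simp
  then show ?thesis
  proof (rule principal_domain.intro, unfold_locales)
    fix J assume J: "ideal J S"
    obtain a where a: "a \<in> carrier V" "{r \<in> carrier V. h r \<in> J} = PIdl\<^bsub>V\<^esub> a"
      using V.exists_gen[OF h.ideal_vimage[OF J]] by auto
    have "J \<subseteq> PIdl\<^bsub>S\<^esub> (h a)"
    proof
      fix y assume y: "y \<in> J"
      then obtain x where x: "x \<in> carrier V" "y = h x"
        using surj ideal.Icarr[OF J] by (metis imageE)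
      hence "x \<in> PIdl\<^bsub>V\<^esub> a" using a(2) y by auto
      then obtain z where "z \<in> carrier V" "x = z \<otimes>\<^bsub>V\<^esub> a" by (auto simp: cgenideal_def)
      thus "y \<in> PIdl\<^bsub>S\<^esub> (h a)" using a x by (auto simp: cgenideal_def)
    qed
    moreover have "a \<in> PIdl\<^bsub>V\<^esub> a" using V.cgenideal_self a(1) .
    hence "h a \<in> J" using a(2) by auto
    hence "PIdl\<^bsub>S\<^esub> (h a) \<subseteq> J" using ideal.I_l_closed[OF J] by (auto simp: cgenideal_def)
    ultimately show "\<exists>a\<in>carrier S. J = PIdl\<^bsub>S\<^esub> a" using a(1) by auto
  qed
qed

lemma krull_dim_eq_1:
  assumes "{P. primeideal P R} = {p, m}" "p \<subset> m"
  shows "krull_dim R = 1"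
proof -
  let ?C = "{enat n | n. \<exists>P :: nat \<Rightarrow> 'a set.
     (\<forall>i\<le>n. primeideal (P i) R) \<and> (\<forall>i<n. P i \<subset> P (Suc i))}"
  have prime: "primeideal P R \<longleftrightarrow> P = p \<or> P = m" for P using assms(1) by blast
  have "enat 1 \<in> ?C"
    using assms(2) prime
    by (intro CollectI exI[of _ 1] conjI refl exI[of _ "\<lambda>i. if i = 0 then p else m"]) auto
  moreover have "x \<le> 1" if x: "x \<in> ?C" for x
  proof -
    obtain n P where n: "x = enat n" and P: "\<forall>i\<le>n. primeideal (P i) R" "\<forall>i<n. P i \<subset> P (Suc i)"
      using x by auto
    have "n \<le> 1"
    proof (rule ccontr)
      assume "\<not> n \<le> 1"
      hence "P 0 \<subset> P 1" "P 1 \<subset> P 2" "P 0 \<in> {p,m}" "P 1 \<in> {p,m}" "P 2 \<in> {p,m}"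
        using P prime by (auto simp: numeral_2_eq_2)
      thus False using assms(2) by auto
    qed
    thus ?thesis by (simp add: n one_enat_def)
  qed
  ultimately show ?thesis
    unfolding krull_dim_def by (intro antisym Sup_least Sup_upper) (auto simp: one_enat_def)
qed

section \<open>Formal power series over a field form a discrete valuation ring\<close>

definition fps_ring :: "'k::field fps ring" where
  "fps_ring = \<lparr>carrier = UNIV, mult = (*), one = 1, zero = 0, add = (+)\<rparr>"

lemma fps_ring_simps [simp]:
  "carrier fps_ring = UNIV" "x \<otimes>\<^bsub>fps_ring\<^esub> y = x * y" "\<one>\<^bsub>fps_ring\<^esub> = 1"
  "\<zero>\<^bsub>fps_ring\<^esub> = 0" "x \<oplus>\<^bsub>fps_ring\<^esub> y = x + y"
  by (simp_all add: fps_ring_def)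

lemma domain_fps_ring: "domain (fps_ring :: 'k::field fps ring)"
proof -
  have "cring (fps_ring :: 'k fps ring)"
  proof (rule cringI)
    show "abelian_group (fps_ring :: 'k fps ring)"
      by (rule abelian_groupI) (auto intro: exI[of _ "- _"] simp: algebra_simps)
    show "comm_monoid (fps_ring :: 'k fps ring)"
      by (rule comm_monoidI) (auto simp: algebra_simps)
  qed (auto simp: algebra_simps)
  thus ?thesis by (auto intro!: domain.intro domain_axioms.intro)
qed

text \<open>
  Divisibility in \<open>k[[X]]\<close> is comparison of orders of vanishing, so an element of least order
  divides all others. Applied to an ideal, this produces a generator.
\<close>

lemma fps_common_divisor_in_set:
  fixes J :: "'k::field fps set"
  assumes "0 \<in> J"
  obtains g where "g \<in> J" "\<And>x. x \<in> J \<Longrightarrow> g dvd x"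
proof (cases "J \<subseteq> {0}")
  case True thus ?thesis using assms that[of 0] by auto
next
  case False
  then obtain g where g: "g \<in> J - {0}" "\<And>x. x \<in> J - {0} \<Longrightarrow> subdegree g \<le> subdegree x"
    using ex_has_least_nat[of "\<lambda>x. x \<in> J - {0}" _ subdegree] by blast
  have "g dvd x" if "x \<in> J" for x
    using g that by (cases "x = 0") (auto simp: fps_dvd_iff)
  thus ?thesis using g(1) that by blast
qed

lemma principal_domain_fps_ring: "principal_domain (fps_ring :: 'k::field fps ring)"
proof (rule principal_domain.intro[OF domain_fps_ring], unfold_locales)
  fix I :: "'k fps set" assume I: "ideal I fps_ring"
  have "0 \<in> I" using additive_subgroup.zero_closed[OF ideal.axioms(1)[OF I]] by simp
  then obtain g where g: "g \<in> I" "\<And>x. x \<in> I \<Longrightarrow> g dvd x"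
    using fps_common_divisor_in_set[of I] by blast
  have "I = PIdl\<^bsub>fps_ring\<^esub> g"
    using g ideal.I_l_closed[OF I g(1)] by (auto simp: cgenideal_def dvd_def mult.commute)
  thus "\<exists>a\<in>carrier fps_ring. I = PIdl\<^bsub>fps_ring\<^esub> a" by auto
qed

lemma fps_not_dvd_1_iff: "\<not> x dvd 1 \<longleftrightarrow> fps_X dvd x" for x :: "'k::field fps"
  by (cases "x = 0") (auto simp: fps_dvd_iff Suc_le_eq subdegree_eq_0_iff intro: gr0I)

lemma primeideal_zero_fps_ring: "primeideal {0} (fps_ring :: 'k::field fps ring)"
  using domain.zeroprimeideal[OF domain_fps_ring] by simp

lemma primeideal_nonunits_fps_ring:
  "primeideal {x. \<not> x dvd 1} (fps_ring :: 'k::field fps ring)"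
proof -
  interpret V: domain "fps_ring :: 'k fps ring" by (rule domain_fps_ring)
  have "ideal {x. \<not> x dvd 1} (fps_ring :: 'k fps ring)" by (rule V.ideal_if_closed) auto
  thus ?thesis by (rule primeidealI) (use V.cring_axioms in \<open>auto simp del: fps_is_unit_iff\<close>)
qed

text \<open>
  A nonzero prime contains some nonzero \<open>x\<close>, hence the power of \<open>X\<close> to which \<open>x\<close> is associated,
  hence \<open>X\<close> itself, and \<open>X\<close> generates the ideal of all nonunits.
\<close>

lemma primeideal_fps_ring_cases:
  assumes "primeideal P (fps_ring :: 'k::field fps ring)"
  shows "P = {0} \<or> P = {x. \<not> x dvd 1}"
proof -
  interpret P: primeideal P "fps_ring :: 'k fps ring" by fact
  have zero: "0 \<in> P" using additive_subgroup.zero_closed[OF P.additive_subgroup_axioms] by simp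
  have mult: "x dvd y \<Longrightarrow> y \<in> P" if "x \<in> P" for x y
    using P.I_r_closed[OF that] by (auto elim: dvdE)
  show ?thesis
  proof (cases "P \<subseteq> {0}")
    case True thus ?thesis using zero by blast
  next
    case False
    have "x \<notin> P" if "x dvd 1" for x
      using mult[OF _ that] P.one_imp_carrier P.I_notcarr by auto
    moreover from this have fps_X: "fps_X ^ k \<in> P \<Longrightarrow> fps_X \<in> P" for k
      by (induction k) (use P.I_prime[of fps_X] in \<open>auto simp del: fps_is_unit_iff\<close>)
    obtain x where x: "x \<in> P" "x \<noteq> 0" using False by blast
    have "x dvd fps_X ^ subdegree x" using x(2) by (simp add: fps_dvd_iff)
    hence "fps_X \<in> P" using mult x(1) fps_X by blast
    hence "y \<in> P" if "\<not> y dvd 1" for y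
      using mult that fps_not_dvd_1_iff by blast
    ultimately show ?thesis by blast
  qed
qed

lemma discrete_valuation_ring_fps_ring:
  "discrete_valuation_ring (fps_ring :: 'k::field fps ring)"
proof -
  have "fps_X \<in> {x. \<not> x dvd (1 :: 'k fps)}" "(fps_X :: 'k fps) \<noteq> 0" by auto
  hence "{x. \<not> x dvd (1 :: 'k fps)} \<noteq> {0}" by blast
  thus ?thesis
    using principal_domain_fps_ring primeideal_nonunits_fps_ring primeideal_fps_ring_cases
    unfolding discrete_valuation_ring_def fps_ring_simps by metis
qed

section \<open>The trivial extension of \<open>k[[X]]\<close> by \<open>k[[X]] \<oplus> k\<close>\<close>

text \<open>
  Power series act on the last component through the residue map \<open>v \<mapsto> v(0)\<close>.
\<close>

definition trivial_ext_ring :: "('k::field fps \<times> 'k fps \<times> 'k) ring" where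
  "trivial_ext_ring =
     \<lparr>carrier = UNIV,
      mult = (\<lambda>(v, b, c) (v', b', c').
        (v * v', v * b' + v' * b, fps_nth v 0 * c' + fps_nth v' 0 * c)),
      one = (1, 0, 0), zero = (0, 0, 0),
      add = (\<lambda>(v, b, c) (v', b', c'). (v + v', b + b', c + c'))\<rparr>"

lemma trivial_ext_ring_simps [simp]:
  "carrier trivial_ext_ring = UNIV"
  "(v, b, c) \<otimes>\<^bsub>trivial_ext_ring\<^esub> (v', b', c') =
     (v * v', v * b' + v' * b, fps_nth v 0 * c' + fps_nth v' 0 * c)"
  "\<one>\<^bsub>trivial_ext_ring\<^esub> = (1, 0, 0)"
  "\<zero>\<^bsub>trivial_ext_ring\<^esub> = (0, 0, 0)"
  "(v, b, c) \<oplus>\<^bsub>trivial_ext_ring\<^esub> (v', b', c') = (v + v', b + b', c + c')"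
  by (simp_all add: trivial_ext_ring_def)

lemma cring_trivial_ext_ring: "cring (trivial_ext_ring :: ('k::field fps \<times> 'k fps \<times> 'k) ring)"
proof (rule cringI)
  let ?R = "trivial_ext_ring :: ('k fps \<times> 'k fps \<times> 'k) ring"
  show "abelian_group ?R"
  proof (rule abelian_groupI)
    fix x :: "'k fps \<times> 'k fps \<times> 'k"
    show "\<exists>y\<in>carrier ?R. y \<oplus>\<^bsub>?R\<^esub> x = \<zero>\<^bsub>?R\<^esub>"
      by (cases x) (auto intro!: exI[of _ "- _"])
  qed (auto simp: split_paired_all algebra_simps)
  show "comm_monoid ?R"
    by (rule comm_monoidI) (auto simp: split_paired_all algebra_simps)
qed (auto simp: split_paired_all algebra_simps)

lemma ideal_trivial_ext_ringD:
  fixes I :: "('k::field fps \<times> 'k fps \<times> 'k) set"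
  assumes "ideal I trivial_ext_ring"
  shows "(0, 0, 0) \<in> I"
    and "(v, b, c) \<in> I \<Longrightarrow> (v', b', c') \<in> I \<Longrightarrow> (v + v', b + b', c + c') \<in> I"
    and "(v, b, c) \<in> I \<Longrightarrow> (r * v, r * b + v * s, fps_nth r 0 * c + fps_nth v 0 * q) \<in> I"
proof -
  interpret I: ideal I trivial_ext_ring by fact
  show "(0, 0, 0) \<in> I"
    using additive_subgroup.zero_closed[OF I.additive_subgroup_axioms] by simp
  show "(v + v', b + b', c + c') \<in> I" if "(v, b, c) \<in> I" "(v', b', c') \<in> I"
    using additive_subgroup.a_closed[OF I.additive_subgroup_axioms that] by simp
  show "(r * v, r * b + v * s, fps_nth r 0 * c + fps_nth v 0 * q) \<in> I" if "(v, b, c) \<in> I"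
    using I.I_l_closed[OF that, of "(r, s, q)"] by simp
qed

lemma ring_hom_fst_trivial_ext_ring:
  "ring_hom_ring (trivial_ext_ring :: ('k::field fps \<times> 'k fps \<times> 'k) ring) fps_ring fst"
proof (rule ring_hom_ringI2)
  show "ring (trivial_ext_ring :: ('k fps \<times> 'k fps \<times> 'k) ring)"
    by (rule cring.axioms(1)[OF cring_trivial_ext_ring])
  show "ring (fps_ring :: 'k fps ring)"
    by (rule cring.axioms(1)[OF domain.axioms(1)[OF domain_fps_ring]])
qed (rule ring_hom_memI, auto simp: split_paired_all)

text \<open>The splitting of \<open>fst\<close>, along which primes of the extension are pulled back.\<close>

lemma ring_hom_section_trivial_ext_ring:
  "ring_hom_ring fps_ring (trivial_ext_ring :: ('k::field fps \<times> 'k fps \<times> 'k) ring) (\<lambda>v. (v, 0, 0))"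
proof (rule ring_hom_ringI2)
  show "ring (trivial_ext_ring :: ('k fps \<times> 'k fps \<times> 'k) ring)"
    by (rule cring.axioms(1)[OF cring_trivial_ext_ring])
  show "ring (fps_ring :: 'k fps ring)"
    by (rule cring.axioms(1)[OF domain.axioms(1)[OF domain_fps_ring]])
qed (rule ring_hom_memI, auto)

lemma kernel_fst_trivial_ext_ring:
  "a_kernel (trivial_ext_ring :: ('k::field fps \<times> 'k fps \<times> 'k) ring) fps_ring fst = fst -` {0}"
  by (simp add: a_kernel_def' vimage_def)

lemma kernel_squared_trivial_ext_ring:
  "ideal_prod (trivial_ext_ring :: ('k::field fps \<times> 'k fps \<times> 'k) ring) (fst -` {0}) (fst -` {0})
     = {(0, 0, 0)}" (is "?K = _")
proof -
  have "x = (0, 0, 0)" if "x \<in> ?K" for x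
    using that
  proof induction
    case (prod i j)
    thus ?case by (cases i, cases j) simp
  next
    case (sum s t)
    thus ?case by simp
  qed
  moreover have "(0, 0, 0) \<otimes>\<^bsub>trivial_ext_ring\<^esub> (0, 0, 0) \<in> ?K"
    by (rule ideal_prod.prod) simp_all
  hence "(0, 0, 0) \<in> ?K" by simp
  ultimately show ?thesis by blast
qed

lemma square_zero_extension_trivial_ext_ring:
  "square_zero_extension fps_ring (trivial_ext_ring :: ('k::field fps \<times> 'k fps \<times> 'k) ring) fst"
proof -
  have "range (fst :: 'k fps \<times> 'k fps \<times> 'k \<Rightarrow> _) = UNIV" by simp
  thus ?thesis
    using cring_trivial_ext_ring domain.axioms(1)[OF domain_fps_ring]
      ring_hom_ring.homh[OF ring_hom_fst_trivial_ext_ring]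
    by (simp add: square_zero_extension_def kernel_fst_trivial_ext_ring
        kernel_squared_trivial_ext_ring)
qed

text \<open>
  Filter \<open>R\<close> by the triples that vanish in the first component and those that vanish in the
  first two. The leading terms of an ideal in each of the three layers form an ideal of \<open>V\<close>, an
  ideal of \<open>V\<close>, and a subspace of \<open>k\<close>, each generated by one element; lifts of these three
  generators generate the ideal, by successive subtraction.
\<close>

lemma noetherian_trivial_ext_ring:
  "noetherian_ring (trivial_ext_ring :: ('k::field fps \<times> 'k fps \<times> 'k) ring)"
proof -
  let ?R = "trivial_ext_ring :: ('k fps \<times> 'k fps \<times> 'k) ring"
  interpret R: cring ?R by (rule cring_trivial_ext_ring)
  show ?thesis
  proof (rule R.noetherian_ringI)
    fix I assume I: "ideal I ?R"
    have zero: "(0, 0, 0) \<in> I" using ideal_trivial_ext_ringD(1)[OF I] .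
    have sub_mult: "(v - r * v', b - r * b', c - fps_nth r 0 * c') \<in> J"
      if "ideal J ?R" "(v, b, c) \<in> J" "(v', b', c') \<in> J" for J r v b c v' b' c'
      using ideal_trivial_ext_ringD(2)[OF that(1,2)
          ideal_trivial_ext_ringD(3)[OF that(1,3), of "- r" 0 0]] by simp
    have "0 \<in> fst ` I" by (rule image_eqI[OF _ zero]) simp
    then obtain g0 where "g0 \<in> fst ` I" and g0: "\<And>v. v \<in> fst ` I \<Longrightarrow> g0 dvd v"
      using fps_common_divisor_in_set[of "fst ` I"] by blast
    then obtain b0 c0 where x0: "(g0, b0, c0) \<in> I" by auto
    obtain g1 where "g1 \<in> {b. \<exists>c. (0, b, c) \<in> I}"
      and g1: "\<And>b. b \<in> {b. \<exists>c. (0, b, c) \<in> I} \<Longrightarrow> g1 dvd b"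
      using fps_common_divisor_in_set[of "{b. \<exists>c. (0, b, c) \<in> I}"] zero by blast
    then obtain c1 where x1: "(0, g1, c1) \<in> I" by auto
    obtain g2 where x2: "(0, 0, g2) \<in> I" and g2: "\<And>c. (0, 0, c) \<in> I \<Longrightarrow> g2 = 0 \<longrightarrow> c = 0"
    proof (cases "\<exists>c. c \<noteq> 0 \<and> (0, 0, c) \<in> I")
      case True
      then obtain c where "c \<noteq> 0" "(0, 0, c) \<in> I" by blast
      thus ?thesis using that[of c] by simp
    next
      case False
      thus ?thesis using that[OF zero] by blast
    qed
    \<comment> \<open>One generator for each layer; \<open>g2 = 0\<close> occurs exactly if the last layer of the ideal is zero.\<close>
    define A where "A = {(g0, b0, c0), (0, g1, c1), (0, 0, g2)}"
    have IA: "ideal (Idl\<^bsub>?R\<^esub> A) ?R" by (rule R.genideal_ideal) auto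
    have A: "(g0, b0, c0) \<in> Idl\<^bsub>?R\<^esub> A" "(0, g1, c1) \<in> Idl\<^bsub>?R\<^esub> A" "(0, 0, g2) \<in> Idl\<^bsub>?R\<^esub> A"
      using R.genideal_self[of A] by (auto simp: A_def)
    have "Idl\<^bsub>?R\<^esub> A \<subseteq> I"
      using R.genideal_minimal[OF I] x0 x1 x2 by (simp add: A_def)
    moreover have "(v, b, c) \<in> Idl\<^bsub>?R\<^esub> A" if x: "(v, b, c) \<in> I" for v b c
    proof -
      have "g0 dvd v" by (rule g0[OF image_eqI[OF _ x]]) simp
      then obtain r where r: "v = r * g0" by (metis dvdE mult.commute)
      have y: "(0, b - r * b0, c - fps_nth r 0 * c0) \<in> I"
        using sub_mult[OF I x x0, of r] r by simp
      hence "g1 dvd b - r * b0" using g1 by blast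
      then obtain s where s: "b - r * b0 = s * g1" by (metis dvdE mult.commute)
      have z: "(0, 0, c - fps_nth r 0 * c0 - fps_nth s 0 * c1) \<in> I"
        using sub_mult[OF I y x1, of s] s by simp
      define q where "q = (c - fps_nth r 0 * c0 - fps_nth s 0 * c1) / g2"
      have q: "c - fps_nth r 0 * c0 - fps_nth s 0 * c1 = q * g2"
        using g2[OF z] by (auto simp: q_def)
      \<comment> \<open>Rebuild \<open>(v, b, c)\<close> from the zero triple, undoing the three subtractions in reverse order.\<close>
      have "(0, 0, 0) \<in> Idl\<^bsub>?R\<^esub> A" using ideal_trivial_ext_ringD(1)[OF IA] .
      from sub_mult[OF IA this A(3), of "- fps_const q"] 
      have "(0, 0, q * g2) \<in> Idl\<^bsub>?R\<^esub> A" by simp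
      from sub_mult[OF IA this A(2), of "- s"]
      have "(0, s * g1, q * g2 + fps_nth s 0 * c1) \<in> Idl\<^bsub>?R\<^esub> A" by simp
      from sub_mult[OF IA this A(1), of "- r"]
      show ?thesis by (simp flip: r s q)
    qed
    ultimately have "I = Idl\<^bsub>?R\<^esub> A" by auto
    thus "\<exists>A\<subseteq>carrier ?R. finite A \<and> I = Idl\<^bsub>?R\<^esub> A"
      by (intro exI[of _ A]) (auto simp: A_def)
  qed
qed

section \<open>Primes of the trivial extension\<close>

text \<open>
  Elements of the kernel of \<open>fst\<close> have square zero, so they lie in every prime; membership in a
  prime then depends on the first component only.
\<close>

lemma primeideal_trivial_ext_ring_iff:
  fixes P :: "('k::field fps \<times> 'k fps \<times> 'k) set"
  shows "primeideal P trivial_ext_ring \<longleftrightarrow> (\<exists>Q. primeideal Q fps_ring \<and> P = fst -` Q)"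
proof
  let ?R = "trivial_ext_ring :: ('k fps \<times> 'k fps \<times> 'k) ring"
  assume "primeideal P ?R"
  then interpret P: primeideal P ?R .
  note ideal = ideal_trivial_ext_ringD[OF P.ideal_axioms]
  have nil: "(0, b, c) \<in> P" for b c
    using P.I_prime[of "(0, b, c)" "(0, b, c)"] ideal(1) by simp
  have proj: "(v, b, c) \<in> P \<longleftrightarrow> (v, 0, 0) \<in> P" for v b c
    using ideal(2)[OF _ nil, of v b c "- b" "- c"] ideal(2)[OF _ nil, of v 0 0 b c] by auto
  have "x \<in> P \<longleftrightarrow> x \<in> fst -` {v. (v, 0, 0) \<in> P}" for x
    by (cases x) (simp, rule proj)
  hence "P = fst -` {v. (v, 0, 0) \<in> P}" by blast
  moreover have "primeideal {v. (v, 0, 0) \<in> P} (fps_ring :: 'k fps ring)"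
    using ring_hom_ring.primeideal_vimage[OF ring_hom_section_trivial_ext_ring
        domain.axioms(1)[OF domain_fps_ring] P.primeideal_axioms] by simp
  ultimately show "\<exists>Q. primeideal Q fps_ring \<and> P = fst -` Q" by blast
next
  assume "\<exists>Q. primeideal Q fps_ring \<and> P = fst -` Q"
  thus "primeideal P trivial_ext_ring"
    using ring_hom_ring.primeideal_vimage[OF ring_hom_fst_trivial_ext_ring cring_trivial_ext_ring]
    by (auto simp: vimage_def)
qed

lemma primeideals_trivial_ext_ring:
  "{P. primeideal P (trivial_ext_ring :: ('k::field fps \<times> 'k fps \<times> 'k) ring)} =
     {fst -` {0}, fst -` {v. \<not> v dvd 1}}"
  using primeideal_fps_ring_cases primeideal_zero_fps_ring primeideal_nonunits_fps_ring
  unfolding primeideal_trivial_ext_ring_iff by blast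

lemma minimal_psubset_maximal:
  "(fst -` {0} :: ('k::field fps \<times> 'k fps \<times> 'k) set) \<subset> fst -` {v. \<not> v dvd 1}"
proof -
  have "(fps_X, 0, 0) \<in> (fst -` {v. \<not> v dvd 1} :: ('k fps \<times> 'k fps \<times> 'k) set)"
    "(fps_X, 0, 0) \<notin> (fst -` {0} :: ('k fps \<times> 'k fps \<times> 'k) set)" by auto
  moreover have "(fst -` {0} :: ('k fps \<times> 'k fps \<times> 'k) set) \<subseteq> fst -` {v. \<not> v dvd 1}" by auto
  ultimately show ?thesis by blast
qed

lemma Min_primes_trivial_ext_ring:
  "Min_primes (trivial_ext_ring :: ('k::field fps \<times> 'k fps \<times> 'k) ring) = {fst -` {0}}"
proof -
  have prime: "primeideal P (trivial_ext_ring :: ('k fps \<times> 'k fps \<times> 'k) ring) \<longleftrightarrow>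
      P = fst -` {0} \<or> P = fst -` {v. \<not> v dvd 1}" for P
    using primeideals_trivial_ext_ring by blast
  show ?thesis unfolding Min_primes_def prime using minimal_psubset_maximal by blast
qed

lemma Ass_primes_trivial_ext_ring:
  "Ass_primes (trivial_ext_ring :: ('k::field fps \<times> 'k fps \<times> 'k) ring) =
     {fst -` {0}, fst -` {v. \<not> v dvd 1}}"
proof -
  let ?R = "trivial_ext_ring :: ('k fps \<times> 'k fps \<times> 'k) ring"
  have prime: "primeideal P ?R \<longleftrightarrow> P = fst -` {0} \<or> P = fst -` {v. \<not> v dvd 1}" for P
    using primeideals_trivial_ext_ring by blast
  \<comment> \<open>The generator of the summand \<open>k[[X]]\<close> is killed by the minimal prime, that of \<open>k\<close> by the maximal ideal.\<close>
  have "fst -` {0} = {r \<in> carrier ?R. r \<otimes>\<^bsub>?R\<^esub> (0, 1, 0) = \<zero>\<^bsub>?R\<^esub>}"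
    "fst -` {v. \<not> v dvd 1} = {r \<in> carrier ?R. r \<otimes>\<^bsub>?R\<^esub> (0, 0, 1) = \<zero>\<^bsub>?R\<^esub>}"
    by auto
  thus ?thesis unfolding Ass_primes_def prime by auto
qed

lemma quotient_trivial_ext_ring:
  "(trivial_ext_ring :: ('k::field fps \<times> 'k fps \<times> 'k) ring) Quot (fst -` {0})
     \<simeq> (fps_ring :: 'k fps ring)"
proof -
  have "range (fst :: 'k fps \<times> 'k fps \<times> 'k \<Rightarrow> _) = UNIV" by simp
  thus ?thesis
    using ring_hom_ring.FactRing_iso[OF ring_hom_fst_trivial_ext_ring]
    by (simp add: kernel_fst_trivial_ext_ring)
qed

lemma principal_domain_quotient_trivial_ext_ring:
  "principal_domain ((trivial_ext_ring :: ('k::field fps \<times> 'k fps \<times> 'k) ring) Quot (fst -` {0}))"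
proof -
  let ?R = "trivial_ext_ring :: ('k fps \<times> 'k fps \<times> 'k) ring"
  have "primeideal (fst -` {0}) ?R"
    unfolding primeideal_trivial_ext_ring_iff using primeideal_zero_fps_ring by blast
  hence ring: "ring (?R Quot (fst -` {0}))"
    by (intro ideal.quotient_is_ring primeideal.axioms(1))
  show ?thesis
    by (rule principal_domain_ring_iso[OF principal_domain_fps_ring ring
          ring_iso_sym[OF ring quotient_trivial_ext_ring]])
qed

section \<open>A descending chain of pairwise non-isomorphic ideals\<close>

text \<open>
  The last component is zero so that an ideal of this shape has no part in the residue field
  summand, and the elements killed by \<open>(0, 1, 0)\<close> are just the multiples of
  \<open>(0, X\<^sup>a, 0)\<close>.
\<close>

definition staircase_ideal :: "nat \<Rightarrow> nat \<Rightarrow> ('k::field fps \<times> 'k fps \<times> 'k) set" where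
  "staircase_ideal d a = {(v, b, c). fps_X ^ d dvd v \<and> fps_X ^ a dvd b \<and> c = 0}"

lemma mem_staircase_ideal:
  "(v, b, c) \<in> staircase_ideal d a \<longleftrightarrow> fps_X ^ d dvd v \<and> fps_X ^ a dvd b \<and> c = 0"
  by (simp add: staircase_ideal_def)

lemma staircase_ideal_antimono:
  assumes "d \<le> d'" "a \<le> a'"
  shows "(staircase_ideal d' a' :: ('k::field fps \<times> 'k fps \<times> 'k) set) \<subseteq> staircase_ideal d a"
proof (rule subsetI)
  fix x :: "'k fps \<times> 'k fps \<times> 'k" assume "x \<in> staircase_ideal d' a'"
  then obtain v b where x: "x = (v, b, 0)" and v: "fps_X ^ d' dvd v" and b: "fps_X ^ a' dvd b"
    by (cases x) (auto simp: mem_staircase_ideal)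
  show "x \<in> staircase_ideal d a"
    unfolding x mem_staircase_ideal
    using dvd_trans[OF le_imp_power_dvd[OF assms(1)] v]
      dvd_trans[OF le_imp_power_dvd[OF assms(2)] b] by simp
qed

text \<open>
  Multiplying \<open>(v, b, 0)\<close> by \<open>(0, s, q)\<close> gives \<open>(0, v s, v(0) q)\<close>. The hypothesis \<open>a \<le> d\<close> puts
  \<open>v s\<close> into the second component of the ideal, and \<open>0 < d\<close> makes \<open>v(0)\<close> vanish.
\<close>

lemma ideal_staircase:
  assumes "a \<le> d" "0 < d"
  shows "ideal (staircase_ideal d a :: ('k::field fps \<times> 'k fps \<times> 'k) set) trivial_ext_ring"
proof -
  let ?R = "trivial_ext_ring :: ('k fps \<times> 'k fps \<times> 'k) ring"
  let ?I = "staircase_ideal d a :: ('k fps \<times> 'k fps \<times> 'k) set"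
  interpret cring ?R by (rule cring_trivial_ext_ring)
  have nonunit: "fps_nth v 0 = 0" if "fps_X ^ d dvd v" for v :: "'k fps"
  proof -
    have "fps_X ^ 1 dvd v"
      by (rule dvd_trans[OF le_imp_power_dvd that]) (use assms(2) in simp)
    thus ?thesis using fps_not_dvd_1_iff[of v] by simp
  qed
  have weaken: "fps_X ^ a dvd v" if "fps_X ^ d dvd v" for v :: "'k fps"
    using le_imp_power_dvd[OF assms(1)] that by (rule dvd_trans)
  show ?thesis
  proof (rule ideal_if_closed)
    fix x y assume "x \<in> ?I" "y \<in> ?I"
    thus "x \<oplus>\<^bsub>?R\<^esub> y \<in> ?I"
      by (cases x, cases y) (simp add: mem_staircase_ideal)
  next
    fix r x :: "'k fps \<times> 'k fps \<times> 'k" assume "x \<in> ?I"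
    then obtain v b where x: "x = (v, b, 0)" and v: "fps_X ^ d dvd v" and b: "fps_X ^ a dvd b"
      by (cases x) (auto simp: mem_staircase_ideal)
    obtain p s q where r: "r = (p, s, q)" by (cases r)
    have "fps_X ^ a dvd p * b + v * s" by (intro dvd_add dvd_mult dvd_mult2 weaken v b)
    thus "r \<otimes>\<^bsub>?R\<^esub> x \<in> ?I"
      unfolding x r trivial_ext_ring_simps mem_staircase_ideal
      by (simp add: v nonunit[OF v])
  next
    show "\<zero>\<^bsub>?R\<^esub> \<in> ?I" unfolding trivial_ext_ring_simps mem_staircase_ideal by simp
  qed simp
qed

text \<open>
  The invariant \<open>d - a\<close> is the least exponent \<open>j\<close> such that \<open>X\<^sup>j\<close> moves the annihilator of
  \<open>s = (0, 1, 0)\<close> in the ideal into \<open>s\<close> times the ideal. The inequality \<open>d - a \<le> e - b\<close>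
  results from transporting along the isomorphism \<open>h\<close> the fact that \<open>X\<^sup>e\<^sup>-\<^sup>b\<close> does so in the
  second ideal; it is stated without subtraction.
\<close>

lemma ideal_iso_staircase_imp_le:
  assumes "ideal_iso trivial_ext_ring
             (staircase_ideal d a :: ('k::field fps \<times> 'k fps \<times> 'k) set) (staircase_ideal e b)"
    and "a \<le> d" "b \<le> e" "0 < d"
  shows "d + b \<le> e + a"
proof -
  let ?R = "trivial_ext_ring :: ('k fps \<times> 'k fps \<times> 'k) ring"
  let ?I = "staircase_ideal d a :: ('k fps \<times> 'k fps \<times> 'k) set"
  let ?J = "staircase_ideal e b :: ('k fps \<times> 'k fps \<times> 'k) set"
  let ?s = "(0, 1, 0) :: 'k fps \<times> 'k fps \<times> 'k"
  let ?t = "(fps_X ^ (e - b), 0, 0) :: 'k fps \<times> 'k fps \<times> 'k"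
  obtain h where bij: "bij_betw h ?I ?J"
    and mult: "\<forall>r\<in>carrier ?R. \<forall>x\<in>?I. h (r \<otimes>\<^bsub>?R\<^esub> x) = r \<otimes>\<^bsub>?R\<^esub> h x"
    using assms(1) unfolding ideal_iso_def by (elim exE conjE)
  have hmult: "h (r \<otimes>\<^bsub>?R\<^esub> x) = r \<otimes>\<^bsub>?R\<^esub> h x" if "x \<in> ?I" for r x
    by (rule bspec[OF bspec[OF mult] that]) simp
  have closed: "r \<otimes>\<^bsub>?R\<^esub> x \<in> ?I" if "x \<in> ?I" for r x
    using ideal.I_l_closed[OF ideal_staircase[OF assms(2,4)] that] by simp
  have zero: "(0, 0, 0) \<in> ?I" by (simp add: mem_staircase_ideal)
  have hzero: "h (0, 0, 0) = (0, 0, 0)"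
    using hmult[OF zero, of "(0, 0, 0)"] by (cases "h (0, 0, 0)") simp
  \<comment> \<open>\<open>y\<close> generates the annihilator of \<open>s\<close> in the first ideal, so \<open>h y\<close> is killed by \<open>s\<close> too.\<close>
  define y :: "'k fps \<times> 'k fps \<times> 'k" where "y = (0, fps_X ^ a, 0)"
  have y: "y \<in> ?I" by (simp add: y_def mem_staircase_ideal)
  obtain u w c where w: "h y = (u, w, c)" by (cases "h y")
  have "h y \<in> ?J" by (rule bij_betw_apply[OF bij y])
  hence dvd_w: "fps_X ^ b dvd w" and "c = 0" by (simp_all add: w mem_staircase_ideal)
  have "?s \<otimes>\<^bsub>?R\<^esub> h y = (0, 0, 0)"
    using hmult[OF y, of ?s] hzero by (simp add: y_def)
  hence "u = 0" by (simp add: w)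
  \<comment> \<open>\<open>z\<close> witnesses that \<open>X\<^sup>e\<^sup>-\<^sup>b\<close> moves \<open>h y\<close> into \<open>s\<close> times the second ideal; pull it back to \<open>x\<close>.\<close>
  define z :: "'k fps \<times> 'k fps \<times> 'k" where "z = (fps_X ^ (e - b) * w, 0, 0)"
  have "fps_X ^ (e - b) * fps_X ^ b dvd fps_X ^ (e - b) * w"
    by (rule mult_dvd_mono[OF dvd_refl dvd_w])
  hence "fps_X ^ e dvd fps_X ^ (e - b) * w"
    unfolding power_add[symmetric] using assms(3) by simp
  hence "z \<in> ?J" by (simp add: z_def mem_staircase_ideal)
  hence "z \<in> h ` ?I" unfolding bij_betw_imp_surj_on[OF bij] .
  then obtain x where x: "h x = z" "x \<in> ?I" by (elim imageE) (rule that[OF sym])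
  obtain v b' c' where xv: "x = (v, b', c')" by (cases x)
  have dvd_v: "fps_X ^ d dvd v" using x(2) by (simp add: xv mem_staircase_ideal)
  have "?t \<otimes>\<^bsub>?R\<^esub> h y = ?s \<otimes>\<^bsub>?R\<^esub> h x"
    unfolding x(1) w \<open>u = 0\<close> \<open>c = 0\<close> z_def trivial_ext_ring_simps by simp
  hence "h (?t \<otimes>\<^bsub>?R\<^esub> y) = h (?s \<otimes>\<^bsub>?R\<^esub> x)"
    unfolding hmult[OF y] hmult[OF x(2)] .
  hence "?t \<otimes>\<^bsub>?R\<^esub> y = ?s \<otimes>\<^bsub>?R\<^esub> x"
    by (rule inj_onD[OF bij_betw_imp_inj_on[OF bij] _ closed[OF y] closed[OF x(2)]])
  hence "v = fps_X ^ (e - b + a)"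
    unfolding y_def xv trivial_ext_ring_simps power_add by simp
  hence "d \<le> e - b + a" using dvd_v by (simp add: fps_dvd_iff)
  thus ?thesis using assms(3) by simp
qed

lemma not_iso_artinian_trivial_ext_ring:
  "\<not> iso_artinian (trivial_ext_ring :: ('k::field fps \<times> 'k fps \<times> 'k) ring)"
proof
  let ?R = "trivial_ext_ring :: ('k fps \<times> 'k fps \<times> 'k) ring"
  let ?I = "\<lambda>n. staircase_ideal (2 * Suc n) (Suc n) :: ('k fps \<times> 'k fps \<times> 'k) set"
  \<comment> \<open>The index is shifted because exponent \<open>0\<close> in the first component does not give an ideal.\<close>
  assume "iso_artinian ?R"
  moreover have "ideal (?I n) ?R" for n by (rule ideal_staircase) auto
  moreover have "?I (Suc n) \<subseteq> ?I n" for n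
    by (rule staircase_ideal_antimono) simp_all
  ultimately obtain n0 where n0: "\<forall>n\<ge>n0. ideal_iso ?R (?I n) (?I n0)"
    unfolding iso_artinian_def by meson
  have "ideal_iso ?R (?I (Suc n0)) (?I n0)" by (rule n0[rule_format]) simp
  hence "2 * Suc (Suc n0) + Suc n0 \<le> 2 * Suc n0 + Suc (Suc n0)"
    by (rule ideal_iso_staircase_imp_le) auto
  thus False by simp
qed

section \<open>The counterexample\<close>

theorem corollary6p3:
  shows "(\<exists>(V :: base_type ring) (R :: ext_type ring) f p.
            discrete_valuation_ring V \<and> square_zero_extension V R f \<and>
            cring R \<and> noetherian_ring R \<and> krull_dim R = 1 \<and>
            Min_primes R = {p} \<and> ideal_prod R p p = {\<zero>\<^bsub>R\<^esub>} \<and>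
            R Quot p \<simeq> V \<and> principal_domain (R Quot p) \<and>
            Min_primes R \<subset> Ass_primes R \<and> \<not> iso_artinian R) \<and>
         \<not> (\<forall>(R :: ext_type ring) p. question_hypotheses R p \<longrightarrow> iso_artinian R) \<and>
         \<not> (\<forall>(V :: base_type ring) (R :: ext_type ring) f p.
              discrete_valuation_ring V \<and> square_zero_extension V R f \<and>
              question_hypotheses R p \<longrightarrow> iso_artinian R)"
proof -
  let ?V = "fps_ring :: base_type ring"
  let ?R = "trivial_ext_ring :: ext_type ring"
  let ?p = "fst -` {0} :: ext_type set"
  have dim: "krull_dim ?R = 1"
    by (rule krull_dim_eq_1[OF primeideals_trivial_ext_ring minimal_psubset_maximal])
  have Min_Ass: "Min_primes ?R \<subset> Ass_primes ?R"
  proof -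
    have "{P} \<subset> {P, Q}" if "P \<subset> Q" for P Q :: "ext_type set" using that by blast
    thus ?thesis
      unfolding Min_primes_trivial_ext_ring Ass_primes_trivial_ext_ring
      using minimal_psubset_maximal .
  qed
  have square: "ideal_prod ?R ?p ?p = {\<zero>\<^bsub>?R\<^esub>}"
    by (simp add: kernel_squared_trivial_ext_ring)
  have Quot: "?R Quot ?p \<simeq> ?V" by (rule quotient_trivial_ext_ring)
  have "question_hypotheses ?R ?p"
    unfolding question_hypotheses_def
    by (intro conjI cring_trivial_ext_ring noetherian_trivial_ext_ring dim
        Min_primes_trivial_ext_ring principal_domain_quotient_trivial_ext_ring Min_Ass)
  note question = this not_iso_artinian_trivial_ext_ring[where 'k = rat]
  note extension = discrete_valuation_ring_fps_ring[where 'k = rat]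
    square_zero_extension_trivial_ext_ring[where 'k = rat]
  show ?thesis
  proof (intro conjI)
    show "\<exists>(V :: base_type ring) (R :: ext_type ring) f p.
            discrete_valuation_ring V \<and> square_zero_extension V R f \<and>
            cring R \<and> noetherian_ring R \<and> krull_dim R = 1 \<and>
            Min_primes R = {p} \<and> ideal_prod R p p = {\<zero>\<^bsub>R\<^esub>} \<and>
            R Quot p \<simeq> V \<and> principal_domain (R Quot p) \<and>
            Min_primes R \<subset> Ass_primes R \<and> \<not> iso_artinian R"
      by (intro exI[of _ ?V] exI[of _ ?R] exI[of _ fst] exI[of _ ?p] conjI
          extension question(2) square Quot cring_trivial_ext_ring noetherian_trivial_ext_ring dim
          Min_primes_trivial_ext_ring principal_domain_quotient_trivial_ext_ring Min_Ass)
    show "\<not> (\<forall>(R :: ext_type ring) p. question_hypotheses R p \<longrightarrow> iso_artinian R)"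
    proof
      assume "\<forall>(R :: ext_type ring) p. question_hypotheses R p \<longrightarrow> iso_artinian R"
      from this[rule_format, OF question(1)] question(2) show False by contradiction
    qed
    show "\<not> (\<forall>(V :: base_type ring) (R :: ext_type ring) f p.
              discrete_valuation_ring V \<and> square_zero_extension V R f \<and>
              question_hypotheses R p \<longrightarrow> iso_artinian R)"
    proof
      assume "\<forall>(V :: base_type ring) (R :: ext_type ring) f p.
              discrete_valuation_ring V \<and> square_zero_extension V R f \<and>
              question_hypotheses R p \<longrightarrow> iso_artinian R"
      from this[rule_format, OF conjI[OF extension(1) conjI[OF extension(2) question(1)]]]
        question(2) show False by contradiction
    qed
  qed
qed

end
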